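(* Let $P$ be a partition of $\mathcal{R}$ and let $f,g$ be reward objects. If $f$ is not $P$-robust to misspecification with $g$, and $\mathrm{Im}(g)\subseteq\mathrm{Im}(f)$, then for any function $h$ (defined on the codomain of $f$ and $g$), $h\circ f$ is not $P$-robust to misspecification with $h\circ g$.
   Context: $\mathcal{S}$ and $\mathcal{A}$ are finite sets; $\mathcal{R}$ is the set of all functions $R:\mathcal{S}\times\mathcal{A}\times\mathcal{S}\to\mathbb{R}$. A reward object is a function $f:\mathcal{R}\to X$ for some set $X$. For a partition $P$ of $\mathcal{R}$, write $R_1\equiv_P R_2$ if $R_1,R_2$ lie in the same class. $f$ is $P$-admissible if $f(R_1)=f(R_2)\Rightarrow R_1\equiv_P R_2$. $f$ is $P$-robust to misspecification with $g$ if $f$ is $P$-admissible, $f\neq g$, $\mathrm{Im}(g)\subseteq\mathrm{Im}(f)$, and $f(R_1)=g(R_2)\Rightarrow R_1\equiv_P R_2$ for all $R_1,R_2\in\mathcal{R}$. *)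

theory Defs
  imports Complex_Main "HOL-Library.FuncSet" "HOL-Library.Disjoint_Sets"
begin

text \<open>Functions with a restricted domain are elements of \<open>\<rightarrow>\<^sub>E\<close>, i.e. they are \<open>undefined\<close> outside
  their domain, so that HOL equality is equality of functions on the domain. Composition of
  such functions is \<^const>\<open>compose\<close>.\<close>

definition rewards :: "'s set \<Rightarrow> 'a set \<Rightarrow> ('s \<times> 'a \<times> 's \<Rightarrow> real) set" where
  "rewards S A = (S \<times> A \<times> S) \<rightarrow>\<^sub>E (UNIV :: real set)"

definition reward_objects ::
  "'s set \<Rightarrow> 'a set \<Rightarrow> 'x set \<Rightarrow> (('s \<times> 'a \<times> 's \<Rightarrow> real) \<Rightarrow> 'x) set" where
  "reward_objects S A X = rewards S A \<rightarrow>\<^sub>E X"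

definition same_class :: "'r set set \<Rightarrow> 'r \<Rightarrow> 'r \<Rightarrow> bool" where
  "same_class P R1 R2 \<longleftrightarrow> (\<exists>C\<in>P. R1 \<in> C \<and> R2 \<in> C)"

definition admissible ::
  "'s set \<Rightarrow> 'a set \<Rightarrow> ('s \<times> 'a \<times> 's \<Rightarrow> real) set set
    \<Rightarrow> (('s \<times> 'a \<times> 's \<Rightarrow> real) \<Rightarrow> 'x) \<Rightarrow> bool" where
  "admissible S A P f \<longleftrightarrow>
    (\<forall>R1\<in>rewards S A. \<forall>R2\<in>rewards S A. f R1 = f R2 \<longrightarrow> same_class P R1 R2)"

definition robust_to_misspecification ::
  "'s set \<Rightarrow> 'a set \<Rightarrow> ('s \<times> 'a \<times> 's \<Rightarrow> real) set set
    \<Rightarrow> (('s \<times> 'a \<times> 's \<Rightarrow> real) \<Rightarrow> 'x) \<Rightarrow> (('s \<times> 'a \<times> 's \<Rightarrow> real) \<Rightarrow> 'x) \<Rightarrow> bool" where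
  "robust_to_misspecification S A P f g \<longleftrightarrow>
    admissible S A P f \<and>
    f \<noteq> g \<and>
    g ` rewards S A \<subseteq> f ` rewards S A \<and>
    (\<forall>R1\<in>rewards S A. \<forall>R2\<in>rewards S A. f R1 = g R2 \<longrightarrow> same_class P R1 R2)"

end

theory Submission
  imports Defs
begin

text \<open>By contraposition: applying \<open>h\<close> preserves equalities, so a condition
  imposed whenever values of the composites agree is already imposed whenever the original values
  agree. Hence robustness passes from the composites back to \<open>f\<close> and \<open>g\<close>,
  except for the image inclusion: \<open>h\<close> may merge values, so that clause has to be
  assumed.\<close>

theorem lemma2p1:
  fixes S :: "'s set" and A :: "'a set"
    and P :: "('s \<times> 'a \<times> 's \<Rightarrow> real) set set"
    and X :: "'x set" and Y :: "'y set"
    and f g :: "('s \<times> 'a \<times> 's \<Rightarrow> real) \<Rightarrow> 'x"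
    and h :: "'x \<Rightarrow> 'y"
  assumes "finite S" and "finite A"
    and "partition_on (rewards S A) P"
    and "f \<in> reward_objects S A X" and "g \<in> reward_objects S A X"
    and "\<not> robust_to_misspecification S A P f g"
    and "g ` rewards S A \<subseteq> f ` rewards S A"
    and "h \<in> X \<rightarrow> Y"
  shows "\<not> robust_to_misspecification S A P
           (compose (rewards S A) h f) (compose (rewards S A) h g)"
proof
  assume "robust_to_misspecification S A P
            (compose (rewards S A) h f) (compose (rewards S A) h g)"
  \<comment> \<open>If \<open>f = g\<close>, the composites would coincide too. For the other two
    clauses, \<open>compose_eq\<close> evaluates the composites at rewards, turning
    \<open>f R1 = f R2\<close> or \<open>f R1 = g R2\<close> into equal composite values.\<close>
  then have "admissible S A P f" and "f \<noteq> g"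
    and "\<forall>R1\<in>rewards S A. \<forall>R2\<in>rewards S A. f R1 = g R2 \<longrightarrow> same_class P R1 R2"
    by (auto simp: robust_to_misspecification_def admissible_def compose_eq)
  \<comment> \<open>The missing fourth clause, the image inclusion, is
    \<open>assms(7)\<close>.\<close>
  with assms(6,7) show False
    by (simp add: robust_to_misspecification_def)
qed

end
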